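(* Let $T_x$ be a rooted tree with root $x$, let $k\ge 1$, and let $L=\{L(v)\}_{v\in V(T_x)}$ be a list assignment with $|L(v)|=k$ for all $v\in V(T_x)$. Then $D(T_x;L)\ge D(T_x;k)$. Moreover, equality $D(T_x;L)=D(T_x;k)$ holds if and only if $D(T_x;L)=0$ or $L(u)=L(v)$ whenever $u$ and $v$ lie in the same orbit of $T_x$.
   Context: A rooted tree $T_x$ is a tree with a distinguished root $x$; its automorphisms are the tree automorphisms fixing $x$, and orbits are orbits of vertices under this automorphism group. A coloring is distinguishing if no nontrivial automorphism preserves all vertex colors. Two colorings $\phi_1,\phi_2$ of rooted trees $T_{v_1},T_{v_2}$ are equivalent if there is an isomorphism $\pi:V(T_{v_1})\to V(T_{v_2})$ with $\pi(v_1)=v_2$ and $\phi_1(u)=\phi_2(\pi(u))$ for all $u$. $D(T_x;k)$ denotes the number of equivalence classes of distinguishing $k$-colorings (colorings with colors in $\{1,\dots,k\}$) of $T_x$, and $D(T_x;L)$ denotes the number of equivalence classes of distinguishing $L$-colorings of $T_x$ (colorings $f$ with $f(v)\in L(v)$ for all $v$). *)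

theory Defs
  imports Main "HOL-Library.FuncSet"
begin

text \<open>
  Edges are unordered pairs, i.e. two-element sets of vertices.  The constant \<open>tree\<close> of the AFP
  entry Graph_Theory is not suitable here: it forbids directed cycles, so a symmetric digraph
  with at least one edge never satisfies it.
\<close>

record 'a rooted_graph =
  tverts :: "'a set"
  tedges :: "'a set set"
  troot :: 'a

definition simple_graph :: "'a set \<Rightarrow> 'a set set \<Rightarrow> bool" where
  "simple_graph V E \<longleftrightarrow> finite V \<and> (\<forall>e\<in>E. e \<subseteq> V \<and> card e = 2)"

definition graph_connected :: "'a set \<Rightarrow> 'a set set \<Rightarrow> bool" where
  "graph_connected V E \<longleftrightarrow> (\<forall>u\<in>V. \<forall>v\<in>V. (u, v) \<in> {(a, b). {a, b} \<in> E}\<^sup>*)"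

definition graph_cycle :: "'a set set \<Rightarrow> 'a list \<Rightarrow> bool" where
  "graph_cycle E p \<longleftrightarrow> length p \<ge> 3 \<and> distinct p \<and>
     (\<forall>i < length p. {p ! i, p ! (Suc i mod length p)} \<in> E)"

definition graph_tree :: "'a set \<Rightarrow> 'a set set \<Rightarrow> bool" where
  "graph_tree V E \<longleftrightarrow> simple_graph V E \<and> V \<noteq> {} \<and> graph_connected V E \<and> (\<nexists>p. graph_cycle E p)"

definition rooted_tree :: "'a rooted_graph \<Rightarrow> bool" where
  "rooted_tree T \<longleftrightarrow> graph_tree (tverts T) (tedges T) \<and> troot T \<in> tverts T"

text \<open>
  Only the values on \<open>tverts T\<^sub>1\<close> matter, so a map \<open>\<pi>\<close> counts as the trivial automorphism
  as soon as it is the identity on the vertices.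
\<close>

definition rooted_iso :: "'a rooted_graph \<Rightarrow> 'b rooted_graph \<Rightarrow> ('a \<Rightarrow> 'b) \<Rightarrow> bool" where
  "rooted_iso T\<^sub>1 T\<^sub>2 \<pi> \<longleftrightarrow>
     bij_betw \<pi> (tverts T\<^sub>1) (tverts T\<^sub>2) \<and>
     (\<forall>u\<in>tverts T\<^sub>1. \<forall>v\<in>tverts T\<^sub>1. {u, v} \<in> tedges T\<^sub>1 \<longleftrightarrow> {\<pi> u, \<pi> v} \<in> tedges T\<^sub>2) \<and>
     \<pi> (troot T\<^sub>1) = troot T\<^sub>2"

abbreviation rooted_aut :: "'a rooted_graph \<Rightarrow> ('a \<Rightarrow> 'a) \<Rightarrow> bool" where
  "rooted_aut T \<equiv> rooted_iso T T"

definition vertex_orbit :: "'a rooted_graph \<Rightarrow> 'a \<Rightarrow> 'a set" where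
  "vertex_orbit T u = {\<pi> u | \<pi>. rooted_aut T \<pi>}"

definition vertex_orbits :: "'a rooted_graph \<Rightarrow> 'a set set" where
  "vertex_orbits T = vertex_orbit T ` tverts T"

definition distinguishing :: "'a rooted_graph \<Rightarrow> ('a \<Rightarrow> 'c) \<Rightarrow> bool" where
  "distinguishing T f \<longleftrightarrow>
     (\<forall>\<pi>. rooted_aut T \<pi> \<and> (\<forall>v\<in>tverts T. f (\<pi> v) = f v) \<longrightarrow> (\<forall>v\<in>tverts T. \<pi> v = v))"

definition equivalent_colorings ::
    "'a rooted_graph \<Rightarrow> ('a \<Rightarrow> 'c) \<Rightarrow> 'b rooted_graph \<Rightarrow> ('b \<Rightarrow> 'c) \<Rightarrow> bool" where
  "equivalent_colorings T\<^sub>1 f\<^sub>1 T\<^sub>2 f\<^sub>2 \<longleftrightarrow>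
     (\<exists>\<pi>. rooted_iso T\<^sub>1 T\<^sub>2 \<pi> \<and> (\<forall>u\<in>tverts T\<^sub>1. f\<^sub>1 u = f\<^sub>2 (\<pi> u)))"

text \<open>
  Colorings are extensional functions on the vertex set, so that each one is counted once.
\<close>

definition dist_list_colorings :: "'a rooted_graph \<Rightarrow> ('a \<Rightarrow> 'c set) \<Rightarrow> ('a \<Rightarrow> 'c) set" where
  "dist_list_colorings T L = {f \<in> (\<Pi>\<^sub>E v\<in>tverts T. L v). distinguishing T f}"

definition num_dist_list :: "'a rooted_graph \<Rightarrow> ('a \<Rightarrow> 'c set) \<Rightarrow> nat" where
  "num_dist_list T L =
     card (dist_list_colorings T L //
       {(f, g) \<in> dist_list_colorings T L \<times> dist_list_colorings T L.
          equivalent_colorings T f T g})"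

definition num_dist :: "'a rooted_graph \<Rightarrow> nat \<Rightarrow> nat" where
  "num_dist T k = num_dist_list T (\<lambda>_. {1..k})"

end

theory Submission
  imports Defs "HOL-Library.Multiset"
begin

text \<open>
  A colored subtree is determined up to equivalence by the color of its root and the multiset of
  the classes of its child subtrees, and a coloring is distinguishing iff at every vertex these
  classes are pairwise distinct. So the classes of distinguishing colorings at \<open>v\<close> are pairs of a color in
  \<open>L v\<close> and a transversal of the family of the class sets \<open>A\<^sub>c\<close> of the children \<open>c\<close> of \<open>v\<close>.
  Children with different shapes have disjoint \<open>A\<^sub>c\<close>, hence the number of transversals is a product
  over the shapes. For \<open>m\<close> sets of size at least \<open>D\<close> there are at least \<open>D choose m\<close> transversals
  (for \<open>a \<in> A\<^sub>1\<close>, count those containing \<open>a\<close> and those avoiding \<open>a\<close>), and if \<open>m \<le> D\<close> then equality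
  forces the sets to coincide and to have size \<open>D\<close>; with constant lists equality holds. Going up
  the tree gives the inequality. Going down the tree in the nonzero equality case, vertices in the
  same orbit have the same class sets, hence the same lists. Conversely, lists that are constant on
  orbits can be recolored orbit by orbit.
\<close>

section \<open>Counting transversals\<close>

text \<open>Images are counted, not choice functions: a subtree class sees only the set of its child
  classes, not which child carries which class.\<close>

definition transversals :: "'i set \<Rightarrow> ('i \<Rightarrow> 'b set) \<Rightarrow> 'b set set" where
  "transversals I A = {g ` I | g. inj_on g I \<and> (\<forall>i\<in>I. g i \<in> A i)}"

lemma transversalsI: "inj_on g I \<Longrightarrow> (\<And>i. i \<in> I \<Longrightarrow> g i \<in> A i) \<Longrightarrow> g ` I \<in> transversals I A"
  by (auto simp: transversals_def)

lemma transversalsE: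
  assumes "X \<in> transversals I A"
  obtains g where "X = g ` I" "inj_on g I" "\<And>i. i \<in> I \<Longrightarrow> g i \<in> A i"
  using assms by (auto simp: transversals_def)

lemma transversals_empty [simp]: "transversals {} A = {{}}"
  by (auto simp: transversals_def)

lemma transversals_subset_Union: "X \<in> transversals I A \<Longrightarrow> X \<subseteq> (\<Union>i\<in>I. A i)"
  by (auto simp: transversals_def)

lemma finite_transversals:
  assumes "finite I" "\<And>i. i \<in> I \<Longrightarrow> finite (A i)"
  shows "finite (transversals I A)"
  by (rule finite_subset[of _ "Pow (\<Union>i\<in>I. A i)"])
    (use assms in \<open>auto dest!: transversals_subset_Union\<close>)

lemma transversals_finite_mem: "finite I \<Longrightarrow> X \<in> transversals I A \<Longrightarrow> finite X"
  by (auto simp: transversals_def)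

lemma transversals_mono:
  "(\<And>i. i \<in> I \<Longrightarrow> A i \<subseteq> B i) \<Longrightarrow> transversals I A \<subseteq> transversals I B"
  by (fastforce simp: transversals_def)

lemma transversals_insert:
  assumes "i \<in> I" "X \<in> transversals (I - {i}) A" "b \<in> A i" "b \<notin> X"
  shows "insert b X \<in> transversals I A"
proof -
  obtain g where g: "X = g ` (I - {i})" "inj_on g (I - {i})" "\<And>j. j \<in> I - {i} \<Longrightarrow> g j \<in> A j"
    using assms(2) by (rule transversalsE) blast
  have "inj_on (g(i := b)) I"
    using g assms(4) unfolding inj_on_def by (auto simp: image_iff)
  moreover have "(g(i := b)) ` I = insert b X"
    using assms(1) g(1) by (auto simp: image_iff)
  ultimately show ?thesis
    using transversalsI[of "g(i := b)" I A] g(3) assms(3) by auto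
qed

lemma transversals_reindex_subset:
  assumes "bij_betw \<beta> I J" "\<And>i. i \<in> I \<Longrightarrow> A i = B (\<beta> i)"
  shows "transversals J B \<subseteq> transversals I A"
proof
  fix X assume "X \<in> transversals J B"
  then obtain g where g: "X = g ` J" "inj_on g J" "\<And>j. j \<in> J \<Longrightarrow> g j \<in> B j"
    by (rule transversalsE) blast
  have "inj_on (g \<circ> \<beta>) I"
    using assms(1) g(2) by (metis bij_betw_def comp_inj_on)
  moreover have "(g \<circ> \<beta>) ` I = X"
    using assms(1) g(1) by (metis bij_betw_def image_comp)
  moreover have "(g \<circ> \<beta>) i \<in> A i" if "i \<in> I" for i
    using assms that g(3) by (simp add: bij_betwE)
  ultimately show "X \<in> transversals I A"
    using transversalsI by metis
qed

lemma transversals_reindex: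
  assumes "bij_betw \<beta> I J" "\<And>i. i \<in> I \<Longrightarrow> A i = B (\<beta> i)"
  shows "transversals I A = transversals J B"
proof (rule equalityI)
  show "transversals J B \<subseteq> transversals I A"
    by (rule transversals_reindex_subset) (use assms in auto)
  show "transversals I A \<subseteq> transversals J B"
  proof (rule transversals_reindex_subset)
    show "bij_betw (inv_into I \<beta>) J I"
      by (rule bij_betw_inv_into[OF assms(1)])
    show "B j = A (inv_into I \<beta> j)" if "j \<in> J" for j
      using assms that by (metis bij_betw_def bij_betw_inv_into_right inv_into_into)
  qed
qed

text \<open>Adding \<open>a\<close> as the representative of \<open>i\<close> to a transversal of
  the other indices that avoids \<open>a\<close> is injective, and the results differ from the
  transversals avoiding \<open>a\<close>. Equality may fail, since some transversals contain
  \<open>a\<close> only as a representative of another index.\<close>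

lemma card_transversals_split:
  assumes "finite I" "\<And>i. i \<in> I \<Longrightarrow> finite (A i)" "i \<in> I" "a \<in> A i"
  shows "card (transversals (I - {i}) (\<lambda>j. A j - {a})) + card (transversals I (\<lambda>j. A j - {a}))
    \<le> card (transversals I A)"
proof -
  let ?A = "\<lambda>j. A j - {a}"
  let ?P = "transversals (I - {i}) ?A" and ?Q = "transversals I ?A"
  have notin: "a \<notin> X" if "X \<in> transversals J ?A" for X J
    using transversals_subset_Union[OF that] by auto
  have "insert a X \<in> transversals I A" if "X \<in> ?P" for X
  proof (rule transversals_insert[where A = A, OF assms(3) _ assms(4) notin[OF that]])
    show "X \<in> transversals (I - {i}) A"
      using that transversals_mono[of "I - {i}" ?A A] by blast
  qed
  moreover have "?Q \<subseteq> transversals I A"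
    by (rule transversals_mono) auto
  ultimately have sub: "insert a ` ?P \<union> ?Q \<subseteq> transversals I A"
    by auto
  have fin: "finite (transversals I A)" "finite ?Q" "finite ?P"
    using assms(1,2) by (auto intro!: finite_transversals)
  have "inj_on (insert a) ?P"
  proof (rule inj_onI)
    fix X Y assume "X \<in> ?P" "Y \<in> ?P" "insert a X = insert a Y"
    then show "X = Y" using insert_ident[of a X Y] notin by simp
  qed
  moreover have "insert a ` ?P \<inter> ?Q = {}"
    using notin by auto
  ultimately have "card (insert a ` ?P \<union> ?Q) = card ?P + card ?Q"
    using fin by (simp add: card_Un_disjoint card_image)
  then show ?thesis
    using card_mono[OF fin(1) sub] by simp
qed

text \<open>Induction on \<open>D\<close>: deleting one element \<open>a\<close> lowers each
  cardinality by at most one, so the two summands of \<open>card_transversals_split\<close> are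
  bounded by the two summands of Pascal's rule.\<close>

lemma card_transversals_ge:
  assumes "finite I" "\<And>i. i \<in> I \<Longrightarrow> finite (A i)" "\<And>i. i \<in> I \<Longrightarrow> D \<le> card (A i)"
  shows "D choose card I \<le> card (transversals I A)"
  using assms
proof (induction D arbitrary: I A)
  case 0
  then show ?case by (cases "I = {}") (auto simp: binomial_eq_0 card_gt_0_iff)
next
  case (Suc D)
  show ?case
  proof (cases "I = {}")
    case False
    then obtain i where i: "i \<in> I" by blast
    with Suc.prems(3)[OF i] obtain a where a: "a \<in> A i" by fastforce
    let ?A = "\<lambda>j. A j - {a}"
    have fin: "finite (?A j)" and ge: "D \<le> card (?A j)" if "j \<in> I" for j
      using Suc.prems(2,3)[OF that] by (auto simp: card_Diff_singleton_if)
    obtain m where m: "card I = Suc m" "card (I - {i}) = m"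
      using i Suc.prems(1) by (metis card.remove)
    have "D choose card (I - {i}) \<le> card (transversals (I - {i}) ?A)"
      by (rule Suc.IH) (use Suc.prems(1) fin ge in auto)
    moreover have "D choose card I \<le> card (transversals I ?A)"
      by (rule Suc.IH) (use Suc.prems(1) fin ge in auto)
    ultimately show ?thesis
      using card_transversals_split[where A = A, OF Suc.prems(1,2) i a] m by simp
  qed simp
qed

text \<open>The same induction with \<open>a\<close> taken from the large set, which stays too large
  after the deletion and makes the second summand strict. The bound on \<open>card I\<close>
  excludes families so large that both sides could be zero; at \<open>card I = Suc D\<close> the
  binomial is zero, but a transversal still exists.\<close>

lemma card_transversals_gr:
  assumes "finite I" "\<And>i. i \<in> I \<Longrightarrow> finite (A i)" "\<And>i. i \<in> I \<Longrightarrow> D \<le> card (A i)"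
    and "i\<^sub>0 \<in> I" "D < card (A i\<^sub>0)" "card I \<le> Suc D"
  shows "D choose card I < card (transversals I A)"
  using assms
proof (induction D arbitrary: A)
  case (0 A)
  then have "I = {i\<^sub>0}"
    by (metis One_nat_def card_0_eq card_1_singletonE empty_iff le_Suc_eq le_zero_eq singletonD)
  moreover obtain a where "a \<in> A i\<^sub>0" using 0 by fastforce
  ultimately have "{a} \<in> transversals I A"
    using transversalsI[of "\<lambda>_. a" I A] by auto
  then have "card (transversals I A) > 0"
    using finite_transversals[OF 0(1,2)] by (auto simp: card_gt_0_iff)
  then show ?case using \<open>I = {i\<^sub>0}\<close> by simp
next
  case (Suc D A)
  obtain m where m: "card I = Suc m" "card (I - {i\<^sub>0}) = m"
    using Suc.prems(1,4) by (metis card.remove)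
  show ?case
  proof (cases "card I \<le> Suc D")
    case False
    \<comment> \<open>The binomial coefficient on the left vanishes here, so one transversal is
      enough: the remaining \<open>m\<close> sets have one by the weak bound, and it has too few
      elements to exhaust the large set.\<close>
    then have D: "m = Suc D" using m Suc.prems(6) by simp
    have "Suc D choose card (I - {i\<^sub>0}) \<le> card (transversals (I - {i\<^sub>0}) A)"
      by (rule card_transversals_ge) (use Suc.prems in auto)
    then have "transversals (I - {i\<^sub>0}) A \<noteq> {}" using D m by auto
    then obtain X where X: "X \<in> transversals (I - {i\<^sub>0}) A" by blast
    then have cX: "finite X" "card X = m"
      using m Suc.prems(1) by (auto simp: transversals_def card_image)
    obtain b where "b \<in> A i\<^sub>0" "b \<notin> X"
      using cX Suc.prems(5) D by (metis card_mono linorder_not_less subsetI)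
    then have "insert b X \<in> transversals I A"
      by (rule transversals_insert[OF Suc.prems(4) X])
    then have "card (transversals I A) > 0"
      using finite_transversals[OF Suc.prems(1,2)] by (auto simp: card_gt_0_iff)
    then show ?thesis using m D by (simp add: binomial_eq_0)
  next
    case True
    obtain a where a: "a \<in> A i\<^sub>0" using Suc.prems(5) by fastforce
    let ?A = "\<lambda>j. A j - {a}"
    have fin: "finite (?A j)" and ge: "D \<le> card (?A j)" if "j \<in> I" for j
      using Suc.prems(2,3)[OF that] by (auto simp: card_Diff_singleton_if)
    have "D choose card (I - {i\<^sub>0}) \<le> card (transversals (I - {i\<^sub>0}) ?A)"
      by (rule card_transversals_ge) (use Suc.prems(1) fin ge in auto)
    moreover have "D choose card I < card (transversals I ?A)"
    proof (rule Suc.IH)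
      show "D < card (?A i\<^sub>0)" using Suc.prems(5) a by (simp add: card_Diff_singleton_if)
    qed (use Suc.prems(1,4) fin ge True in auto)
    ultimately show ?thesis
      using card_transversals_split[where A = A, OF Suc.prems(1,2,4) a] m by simp
  qed
qed

text \<open>A set of size above \<open>D\<close> would make the bound strict. If all sizes are
  \<open>D\<close> and some \<open>a\<close> lies in \<open>A i\<close> but not in
  \<open>A j\<close>, then deleting \<open>a\<close> leaves \<open>A j\<close> at size
  \<open>D\<close> while the general bound drops to \<open>D - 1\<close>, so the transversals
  avoiding \<open>a\<close> are already too many.\<close>

lemma card_transversals_eqD:
  assumes "finite I" "\<And>i. i \<in> I \<Longrightarrow> finite (A i)" "\<And>i. i \<in> I \<Longrightarrow> D \<le> card (A i)"
    and "card I \<le> D" and eq: "card (transversals I A) = D choose card I"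
  shows "i \<in> I \<Longrightarrow> card (A i) = D" "i \<in> I \<Longrightarrow> j \<in> I \<Longrightarrow> A i = A j"
proof -
  show card: "card (A i) = D" if "i \<in> I" for i
    using card_transversals_gr[where A = A and D = D, OF assms(1-3) that] assms(3)[OF that] assms(4) eq
    by fastforce
  show "A i = A j" if ij: "i \<in> I" "j \<in> I" for i j
  proof (rule ccontr)
    assume "A i \<noteq> A j"
    then obtain a where a: "a \<in> A i" "a \<notin> A j"
      using card ij assms(2) by (metis card_subset_eq subsetI)
    obtain m where m: "card I = Suc m" "card (I - {i}) = m"
      using ij assms(1) by (metis card.remove)
    then obtain d where d: "D = Suc d" using assms(4) by (cases D) auto
    let ?A = "\<lambda>j. A j - {a}"
    have fin: "finite (?A j)" and ge: "d \<le> card (?A j)" if "j \<in> I" for j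
      using assms(2,3)[OF that] d by (auto simp: card_Diff_singleton_if)
    have "d choose card (I - {i}) \<le> card (transversals (I - {i}) ?A)"
      by (rule card_transversals_ge) (use assms(1) fin ge in auto)
    moreover have "d choose card I < card (transversals I ?A)"
    proof (rule card_transversals_gr)
      show "d < card (?A j)" using card[OF ij(2)] a d by simp
    qed (use assms fin ge ij d in auto)
    ultimately show False
      using card_transversals_split[where A = A, OF assms(1,2) ij(1) a(1)] m eq d by simp
  qed
qed

lemma card_transversals_const:
  assumes "finite I" "finite X" "\<And>i. i \<in> I \<Longrightarrow> A i = X"
  shows "card (transversals I A) = card X choose card I"
proof -
  have "transversals I A = {Y. Y \<subseteq> X \<and> card Y = card I}"
  proof (intro equalityI subsetI)
    fix Y assume "Y \<in> {Y. Y \<subseteq> X \<and> card Y = card I}"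
    then have Y: "Y \<subseteq> X" "card Y = card I" by auto
    then obtain g where "bij_betw g I Y"
      using assms(1,2) by (metis finite_same_card_bij finite_subset)
    then show "Y \<in> transversals I A"
      using transversalsI[of g I A] Y assms(3) unfolding bij_betw_def by blast
  qed (use assms(3) in \<open>auto simp: transversals_def card_image\<close>)
  then show ?thesis using n_subsets[OF assms(2)] by simp
qed

text \<open>Since the two unions of sets are disjoint, a transversal of the whole family splits
  uniquely into its two parts.\<close>

lemma card_transversals_Un:
  assumes "finite I" "finite J" "I \<inter> J = {}"
    and disj: "\<And>i j. i \<in> I \<Longrightarrow> j \<in> J \<Longrightarrow> A i \<inter> A j = {}"
  shows "card (transversals (I \<union> J) A) = card (transversals I A) * card (transversals J A)"
proof -
  let ?u = "\<lambda>(X, Y). X \<union> Y"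
  have sub: "X \<subseteq> (\<Union>i\<in>K. A i)" if "X \<in> transversals K A" for X K
    using that by (rule transversals_subset_Union)
  have "inj_on ?u (transversals I A \<times> transversals J A)"
  proof (rule inj_onI, clarify)
    fix X Y X' Y'
    assume "X \<in> transversals I A" "Y \<in> transversals J A"
      and "X' \<in> transversals I A" "Y' \<in> transversals J A" and eq: "X \<union> Y = X' \<union> Y'"
    then have s: "X \<subseteq> (\<Union>i\<in>I. A i)" "Y \<subseteq> (\<Union>i\<in>J. A i)" "X' \<subseteq> (\<Union>i\<in>I. A i)" "Y' \<subseteq> (\<Union>i\<in>J. A i)"
      using sub by blast+
    have d: "(\<Union>i\<in>I. A i) \<inter> (\<Union>i\<in>J. A i) = {}" using disj by blast
    show "X = X' \<and> Y = Y'" using s d eq by blast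
  qed
  moreover have "?u ` (transversals I A \<times> transversals J A) = transversals (I \<union> J) A"
  proof (intro equalityI subsetI)
    fix Z assume "Z \<in> ?u ` (transversals I A \<times> transversals J A)"
    then obtain X Y where XY: "Z = X \<union> Y" "X \<in> transversals I A" "Y \<in> transversals J A" by auto
    obtain g where g: "X = g ` I" "inj_on g I" "\<And>i. i \<in> I \<Longrightarrow> g i \<in> A i"
      using XY(2) by (rule transversalsE) blast
    obtain h where h: "Y = h ` J" "inj_on h J" "\<And>i. i \<in> J \<Longrightarrow> h i \<in> A i"
      using XY(3) by (rule transversalsE) blast
    let ?g = "\<lambda>i. if i \<in> I then g i else h i"
    have gh: "g x \<noteq> h y" if "x \<in> I" "y \<in> J" for x y
      using disj[OF that] g(3)[OF that(1)] h(3)[OF that(2)] by auto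
    have "inj_on ?g (I \<union> J)"
    proof (rule inj_onI)
      fix x y assume "x \<in> I \<union> J" "y \<in> I \<union> J" "?g x = ?g y"
      then show "x = y"
        using inj_onD[OF g(2)] inj_onD[OF h(2)] gh[of x y] gh[of y x]
        by (cases "x \<in> I"; cases "y \<in> I") auto
    qed
    moreover have "?g ` (I \<union> J) = Z"
      using g(1) h(1) XY(1) assms(3) by (auto simp: image_iff)
    moreover have "?g i \<in> A i" if "i \<in> I \<union> J" for i
      using that g(3) h(3) by auto
    ultimately show "Z \<in> transversals (I \<union> J) A"
      using transversalsI[of ?g "I \<union> J" A] by metis
  next
    fix Z assume "Z \<in> transversals (I \<union> J) A"
    then obtain g where g: "Z = g ` (I \<union> J)" "inj_on g (I \<union> J)" "\<And>i. i \<in> I \<union> J \<Longrightarrow> g i \<in> A i"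
      by (rule transversalsE) blast
    then have "g ` I \<in> transversals I A" "g ` J \<in> transversals J A"
      by (auto intro!: transversalsI intro: inj_on_subset)
    then show "Z \<in> ?u ` (transversals I A \<times> transversals J A)"
      using g(1) by (auto simp: image_Un intro!: image_eqI[where x = "(g ` I, g ` J)"])
  qed
  ultimately show ?thesis
    by (metis card_cartesian_product card_image)
qed

lemma mult_eq_mult_le_nat:
  fixes a b c d :: nat
  assumes "a * b = c * d" "c \<le> a" "d \<le> b" "0 < c * d"
  shows "a = c \<and> b = d"
proof -
  have "c * d \<le> c * b" "c * b \<le> a * b"
    using assms(2,3) by (auto intro: mult_le_mono)
  then have eqs: "c * d = c * b" "c * b = a * b"
    using assms(1) by linarith+
  have pos: "0 < c" "0 < d"
    using assms(4) by auto
  have "d = b" using eqs(1) pos by simp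
  moreover have "c = a" using eqs(2) pos \<open>d = b\<close> by simp
  ultimately show ?thesis by simp
qed

text \<open>Intended for \<open>s\<close> the shape of a child, \<open>A\<close> its classes for the
  given lists and \<open>B\<close> its classes for a constant list. Fibers of \<open>s\<close> are
  split off one at a time; on each fiber \<open>B\<close> is constant, so its count is exactly the
  binomial that bounds the count for \<open>A\<close> from below.\<close>

lemma card_transversals_compare:
  fixes s :: "'i \<Rightarrow> 's"
  assumes "finite I" "\<And>i. i \<in> I \<Longrightarrow> finite (A i)" "\<And>i. i \<in> I \<Longrightarrow> finite (B i)"
    and "\<And>i. i \<in> I \<Longrightarrow> card (B i) \<le> card (A i)"
    and "\<And>i j. i \<in> I \<Longrightarrow> j \<in> I \<Longrightarrow> s i \<noteq> s j \<Longrightarrow> A i \<inter> A j = {}"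
    and "\<And>i j. i \<in> I \<Longrightarrow> j \<in> I \<Longrightarrow> s i \<noteq> s j \<Longrightarrow> B i \<inter> B j = {}"
    and "\<And>i j. i \<in> I \<Longrightarrow> j \<in> I \<Longrightarrow> s i = s j \<Longrightarrow> B i = B j"
  shows "card (transversals I B) \<le> card (transversals I A) \<and>
    (card (transversals I A) = card (transversals I B) \<longrightarrow> card (transversals I B) > 0 \<longrightarrow>
      (\<forall>i\<in>I. card (A i) = card (B i)) \<and> (\<forall>i\<in>I. \<forall>j\<in>I. s i = s j \<longrightarrow> A i = A j))"
  using assms
proof (induction I rule: finite_psubset_induct)
  case (psubset I)
  note prems = psubset.prems
  show ?case
  proof (cases "I = {}")
    case False
    then obtain i where i: "i \<in> I" by blast
    define J where "J = {j \<in> I. s j = s i}"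
    define K where "K = {j \<in> I. s j \<noteq> s i}"
    have JK: "I = J \<union> K" "J \<inter> K = {}" "K \<subset> I" "finite J" "finite K" "J \<subseteq> I" "K \<subseteq> I"
      using i psubset.hyps by (auto simp: J_def K_def)
    have IH: "card (transversals K B) \<le> card (transversals K A) \<and>
      (card (transversals K A) = card (transversals K B) \<longrightarrow> card (transversals K B) > 0 \<longrightarrow>
        (\<forall>i\<in>K. card (A i) = card (B i)) \<and> (\<forall>i\<in>K. \<forall>j\<in>K. s i = s j \<longrightarrow> A i = A j))"
    proof (rule psubset.IH[OF JK(3)])
      fix j assume "j \<in> K"
      then have "j \<in> I" using JK(7) by blast
      then show "finite (A j)" "finite (B j)" "card (B j) \<le> card (A j)"
        using prems(1-3) by blast+
    next
      fix j l assume "j \<in> K" "l \<in> K"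
      then have jl: "j \<in> I" "l \<in> I" using JK(7) by blast+
      show "A j \<inter> A l = {}" "B j \<inter> B l = {}" if "s j \<noteq> s l"
        using prems(4,5)[OF jl that] by blast+
      show "B j = B l" if "s j = s l"
        by (rule prems(6)[OF jl that])
    qed
    let ?D = "card (B i)"
    have constB: "B j = B i" if "j \<in> J" for j
      using prems(6)[of j i] i that by (simp add: J_def)
    have cJB: "card (transversals J B) = ?D choose card J"
      by (rule card_transversals_const) (use JK prems(2) i constB in auto)
    have geJ: "?D \<le> card (A j)" if "j \<in> J" for j
      using prems(3)[of j] constB[OF that] that JK(6) by auto
    have finJ: "finite (A j)" if "j \<in> J" for j
      using prems(1) that JK(6) by blast
    have leJ: "card (transversals J B) \<le> card (transversals J A)"
      unfolding cJB by (rule card_transversals_ge) (use JK geJ finJ in auto)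
    have dA: "A j \<inter> A l = {}" and dB: "B j \<inter> B l = {}" if "j \<in> J" "l \<in> K" for j l
      using that prems(4,5)[of j l] by (auto simp: J_def K_def)
    have UA: "card (transversals I A) = card (transversals J A) * card (transversals K A)"
      unfolding JK(1) by (rule card_transversals_Un[OF JK(4,5,2) dA])
    have UB: "card (transversals I B) = card (transversals J B) * card (transversals K B)"
      unfolding JK(1) by (rule card_transversals_Un[OF JK(4,5,2) dB])
    have "card (transversals I B) \<le> card (transversals I A)"
      unfolding UA UB using leJ IH by (simp add: mult_le_mono)
    moreover have "(\<forall>i\<in>I. card (A i) = card (B i)) \<and> (\<forall>i\<in>I. \<forall>j\<in>I. s i = s j \<longrightarrow> A i = A j)"
      if eq: "card (transversals I A) = card (transversals I B)" and pos: "card (transversals I B) > 0"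
    proof -
      have eqs: "card (transversals J A) = card (transversals J B)"
        "card (transversals K A) = card (transversals K B)"
        using mult_eq_mult_le_nat[OF eq[unfolded UA UB] leJ conjunct1[OF IH] pos[unfolded UB]] by blast+
      have pos': "0 < card (transversals J B)" "0 < card (transversals K B)"
        using pos[unfolded UB] by simp_all
      then have K: "\<forall>i\<in>K. card (A i) = card (B i)" "\<forall>i\<in>K. \<forall>j\<in>K. s i = s j \<longrightarrow> A i = A j"
        using IH eqs(2) by blast+
      \<comment> \<open>A positive binomial coefficient supplies the size condition of the equality
        case.\<close>
      have "card J \<le> ?D"
        using pos'(1) unfolding cJB by simp
      then have cA: "card (A j) = ?D" and eA: "l \<in> J \<Longrightarrow> A j = A l" if "j \<in> J" for j l
        using card_transversals_eqD[where A = A and I = J and D = ?D, OF JK(4) finJ geJ _ eqs(1)[unfolded cJB]]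
          that by blast+
      have J: "\<forall>j\<in>J. card (A j) = card (B j)" "\<forall>j\<in>J. \<forall>l\<in>J. A j = A l"
        using cA constB by simp (use eA in blast)
      show ?thesis
      proof (intro conjI ballI impI)
        fix j assume "j \<in> I" then show "card (A j) = card (B j)" using J(1) K(1) JK(1) by blast
      next
        fix j l assume "j \<in> I" "l \<in> I" "s j = s l"
        then have "j \<in> J \<and> l \<in> J \<or> j \<in> K \<and> l \<in> K" by (auto simp: J_def K_def)
        then show "A j = A l" using J(2) K(2) \<open>s j = s l\<close> by blast
      qed
    qed
    ultimately show ?thesis by blast
  qed simp
qed

section \<open>Rooted trees by depth\<close>

definition adjacency :: "'a rooted_graph \<Rightarrow> 'a rel" where
  "adjacency T = {(a, b). {a, b} \<in> tedges T}"

definition depth :: "'a rooted_graph \<Rightarrow> 'a \<Rightarrow> nat" where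
  "depth T v = (LEAST n. (troot T, v) \<in> adjacency T ^^ n)"

definition children :: "'a rooted_graph \<Rightarrow> 'a \<Rightarrow> 'a set" where
  "children T v = {w. {v, w} \<in> tedges T \<and> depth T w = Suc (depth T v)}"

locale rooted_tree_graph =
  fixes T :: "'a rooted_graph"
  assumes rooted_tree: "rooted_tree T"
begin

abbreviation V where "V \<equiv> tverts T"
abbreviation E where "E \<equiv> tedges T"
abbreviation r where "r \<equiv> troot T"
abbreviation ch where "ch \<equiv> children T"
abbreviation dep where "dep \<equiv> depth T"

lemma finite_V: "finite V" and root_in_V: "r \<in> V" and acyclic: "\<not> graph_cycle E p"
  using rooted_tree by (auto simp: rooted_tree_def graph_tree_def simple_graph_def)

lemma edge_in_V: "{u, v} \<in> E \<Longrightarrow> u \<in> V \<and> v \<in> V"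
  using rooted_tree by (auto simp: rooted_tree_def graph_tree_def simple_graph_def)

lemma reachable:
  assumes "v \<in> V"
  shows "(r, v) \<in> adjacency T ^^ dep v"
proof -
  have "(r, v) \<in> (adjacency T)\<^sup>*"
    using rooted_tree root_in_V assms
    by (simp add: rooted_tree_def graph_tree_def graph_connected_def adjacency_def)
  then show ?thesis
    unfolding depth_def by (meson LeastI rtrancl_imp_relpow)
qed

lemma depth_le: "(r, v) \<in> adjacency T ^^ n \<Longrightarrow> dep v \<le> n"
  unfolding depth_def by (rule Least_le)

lemma depth_root [simp]: "dep r = 0"
  using depth_le[of r 0] by simp

lemma depth_eq_0D: "v \<in> V \<Longrightarrow> dep v = 0 \<Longrightarrow> v = r"
  using reachable[of v] by simp

lemma depth_edge:
  assumes "{u, v} \<in> E"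
  shows "dep v \<le> Suc (dep u)"
proof (rule depth_le, rule relpow_Suc_I)
  show "(r, u) \<in> adjacency T ^^ dep u"
    using reachable edge_in_V[OF assms] by blast
  show "(u, v) \<in> adjacency T"
    using assms by (simp add: adjacency_def)
qed

lemma children_in_V: "c \<in> ch v \<Longrightarrow> c \<in> V" "c \<in> ch v \<Longrightarrow> v \<in> V"
  using edge_in_V by (auto simp: children_def)

lemma depth_children: "c \<in> ch v \<Longrightarrow> dep c = Suc (dep v)"
  by (simp add: children_def)

lemma root_not_child: "r \<notin> ch v"
  using depth_children by fastforce

lemma finite_children: "finite (ch v)"
  using children_in_V finite_V by (meson finite_subset subsetI)

lemma parent_exists:
  assumes "v \<in> V" "v \<noteq> r"
  obtains p where "v \<in> ch p"
proof -
  obtain n where n: "dep v = Suc n"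
    using assms depth_eq_0D by (cases "dep v") auto
  then obtain p where p: "(r, p) \<in> adjacency T ^^ n" "{p, v} \<in> E"
    using reachable[OF assms(1)] by (auto simp: adjacency_def)
  then have "dep p = n"
    using depth_le[OF p(1)] depth_edge[OF p(2)] n by simp
  then show ?thesis
    using that p(2) n by (auto simp: children_def)
qed

section \<open>Acyclicity: no edges inside a level, and unique parents\<close>

definition walk :: "'a list \<Rightarrow> bool" where
  "walk p \<longleftrightarrow> successively (\<lambda>a b. {a, b} \<in> E) p"

lemma closed_walk_is_cycle:
  assumes "walk p" "distinct p" "length p \<ge> 3" "{last p, hd p} \<in> E"
  shows "graph_cycle E p"
proof -
  have "{p ! i, p ! (Suc i mod length p)} \<in> E" if "i < length p" for i
  proof (cases "Suc i < length p")
    case True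
    then show ?thesis
      using assms(1) by (auto simp: walk_def successively_conv_nth)
  next
    case False
    then have "Suc i = length p" using that by simp
    moreover from this have "p ! i = last p"
      by (metis diff_Suc_1 last_conv_nth length_0_conv nat.distinct(1))
    moreover have "p ! 0 = hd p"
      using assms(3) by (metis hd_conv_nth le_zero_eq length_0_conv numeral_3_eq_3 nat.distinct(1))
    ultimately show ?thesis using assms(4) by simp
  qed
  then show ?thesis using assms(2,3) by (simp add: graph_cycle_def)
qed

text \<open>Climb from both vertices to their parents until these coincide. The depth bound keeps
  the walk free of repetitions when it is extended downwards, and an edge between its ends or a
  common child of them would close it to a cycle.\<close>

lemma level_walk:
  assumes "u \<in> V" "v \<in> V" "u \<noteq> v" "dep u = d" "dep v = d"
  shows "\<exists>p. walk p \<and> distinct p \<and> p \<noteq> [] \<and> hd p = u \<and> last p = v \<and> length p \<ge> 3 \<and> (\<forall>x\<in>set p. dep x \<le> d)"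
  using assms
proof (induction d arbitrary: u v)
  case 0
  then show ?case using depth_eq_0D by metis
next
  case (Suc d)
  then obtain u' v' where uv: "u \<in> ch u'" "v \<in> ch v'"
    by (metis depth_root nat.distinct(1) parent_exists)
  then have e: "{u, u'} \<in> E" "{u', u} \<in> E" "{v', v} \<in> E" "dep u' = d" "dep v' = d" "u' \<in> V" "v' \<in> V"
    using Suc.prems children_in_V by (auto simp: children_def insert_commute)
  show ?case
  proof (cases "u' = v'")
    case True
    then have "walk [u, u', v]" using e by (simp add: walk_def)
    moreover have "distinct [u, u', v]" using Suc.prems e by auto
    ultimately show ?thesis
      using Suc.prems e by (intro exI[of _ "[u, u', v]"]) simp
  next
    case False
    then obtain p where p: "walk p" "distinct p" "p \<noteq> []" "hd p = u'" "last p = v'"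
      "length p \<ge> 3" "\<forall>x\<in>set p. dep x \<le> d"
      using Suc.IH[OF e(6,7) False e(4,5)] by blast
    have "walk (u # p @ [v])"
      using p(1,3,4,5) e by (simp add: walk_def successively_Cons successively_append_iff)
    moreover have "distinct (u # p @ [v])" using Suc.prems p(2,7) by auto
    ultimately show ?thesis
      using Suc.prems p by (intro exI[of _ "u # p @ [v]"]) auto
  qed
qed

lemma no_level_edge:
  assumes "{u, v} \<in> E"
  shows "dep u \<noteq> dep v"
proof
  assume eq: "dep u = dep v"
  have "card {u, v} = 2"
    using assms rooted_tree by (auto simp: rooted_tree_def graph_tree_def simple_graph_def)
  then have "u \<noteq> v" by auto
  then obtain p where "walk p" "distinct p" "hd p = u" "last p = v" "length p \<ge> 3"
    using level_walk[OF _ _ _ refl eq[symmetric]] edge_in_V[OF assms] by blast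
  then show False
    using closed_walk_is_cycle[of p] acyclic assms by (simp add: insert_commute)
qed

lemma parent_unique:
  assumes "w \<in> ch u" "w \<in> ch v"
  shows "u = v"
proof (rule ccontr)
  assume "u \<noteq> v"
  have "dep u = dep v" using assms by (simp add: children_def)
  then obtain p where p: "walk p" "distinct p" "p \<noteq> []" "hd p = u" "last p = v" "length p \<ge> 3"
    "\<forall>x\<in>set p. dep x \<le> dep v"
    using level_walk[of u v "dep v"] assms children_in_V \<open>u \<noteq> v\<close> by blast
  have e: "{v, w} \<in> E" "{w, u} \<in> E" "dep w = Suc (dep v)"
    using assms by (auto simp: children_def insert_commute)
  have "walk (p @ [w])"
    using p e by (simp add: walk_def successively_append_iff)
  moreover have "distinct (p @ [w])" using p(2,7) e(3) by auto
  ultimately have "graph_cycle E (p @ [w])"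
    using closed_walk_is_cycle[of "p @ [w]"] p e by simp
  then show False using acyclic by blast
qed

lemma edge_iff: "{u, v} \<in> E \<longleftrightarrow> v \<in> ch u \<or> u \<in> ch v"
proof
  assume e: "{u, v} \<in> E"
  then have e': "{v, u} \<in> E" by (simp add: insert_commute)
  have "dep u < dep v \<or> dep v < dep u" using no_level_edge[OF e] by linarith
  then show "v \<in> ch u \<or> u \<in> ch v"
    using depth_edge[OF e] depth_edge[OF e'] e e' by (auto simp: children_def)
qed (auto simp: children_def insert_commute)

text \<open>The edge from the parent \<open>p\<close> to \<open>v\<close> goes to an edge, and only
  the direction is in doubt. If \<open>\<pi> v\<close> were the parent of \<open>\<pi> p\<close>, it
  would equal the image of the parent \<open>q\<close> of \<open>p\<close>, and injectivity would
  give \<open>q = v\<close>, against the depths.\<close>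

lemma aut_depth:
  assumes "rooted_aut T \<pi>" "v \<in> V"
  shows "dep (\<pi> v) = dep v"
  using assms(2)
proof (induction "dep v" arbitrary: v rule: less_induct)
  case less
  have bij: "bij_betw \<pi> V V" and edge: "{\<pi> u, \<pi> w} \<in> E" if "{u, w} \<in> E" for u w
    using assms(1) edge_in_V[OF that] that by (auto simp: rooted_iso_def)
  show ?case
  proof (cases "v = r")
    case True
    then show ?thesis using assms(1) by (simp add: rooted_iso_def)
  next
    case False
    then obtain p where p: "v \<in> ch p" using less.prems parent_exists by blast
    then have dp: "dep (\<pi> p) = dep p"
      using less.hyps[of p] depth_children[OF p] children_in_V[OF p] by simp
    have "{p, v} \<in> E" using p by (simp add: children_def)
    then have "\<pi> v \<in> ch (\<pi> p) \<or> \<pi> p \<in> ch (\<pi> v)" using edge edge_iff by blast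
    moreover have "\<pi> p \<notin> ch (\<pi> v)"
    proof
      assume c: "\<pi> p \<in> ch (\<pi> v)"
      then have "p \<noteq> r" using dp depth_children by fastforce
      then obtain q where q: "p \<in> ch q" using parent_exists children_in_V[OF p] by blast
      then have dq: "dep (\<pi> q) = dep q"
        using less.hyps[of q] depth_children[OF p] depth_children[OF q] children_in_V[OF q] by simp
      have e: "{q, p} \<in> E" using q by (simp add: children_def)
      have "\<pi> p \<in> ch (\<pi> q)"
        using edge[OF e] dp dq depth_children[OF q] by (simp add: children_def)
      then have "\<pi> q = \<pi> v" using c parent_unique by blast
      then have "q = v"
        using bij[OF e] children_in_V[OF q] less.prems by (auto simp: bij_betw_def inj_on_def)
      then show False using depth_children[OF p] depth_children[OF q] by simp
    qed
    ultimately show ?thesis using dp depth_children[OF p] depth_children by simp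
  qed
qed

text \<open>Trades edges for sets of children, the form in which automorphisms can be built and
  analyzed from the root downwards.\<close>

lemma rooted_aut_iff:
  "rooted_aut T \<pi> \<longleftrightarrow> bij_betw \<pi> V V \<and> \<pi> r = r \<and> (\<forall>v\<in>V. \<pi> ` ch v = ch (\<pi> v))"
proof (intro iffI conjI ballI)
  assume aut: "rooted_aut T \<pi>"
  then show bij: "bij_betw \<pi> V V" and "\<pi> r = r" by (auto simp: rooted_iso_def)
  fix v assume v: "v \<in> V"
  show "\<pi> ` ch v = ch (\<pi> v)"
  proof (intro equalityI subsetI)
    fix w assume "w \<in> \<pi> ` ch v"
    then obtain c where c: "w = \<pi> c" "c \<in> ch v" by blast
    then show "w \<in> ch (\<pi> v)"
      using aut aut_depth[OF aut] v children_in_V[OF c(2)] by (auto simp: children_def rooted_iso_def)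
  next
    fix w assume w: "w \<in> ch (\<pi> v)"
    then obtain c where c: "w = \<pi> c" "c \<in> V"
      using bij children_in_V[OF w] unfolding bij_betw_def by blast
    then have "{v, c} \<in> E" using aut v w by (auto simp: children_def rooted_iso_def)
    then show "w \<in> \<pi> ` ch v"
      using c w aut_depth[OF aut] v by (auto simp: children_def)
  qed
next
  assume *: "bij_betw \<pi> V V \<and> \<pi> r = r \<and> (\<forall>v\<in>V. \<pi> ` ch v = ch (\<pi> v))"
  have "v \<in> ch u \<longleftrightarrow> \<pi> v \<in> ch (\<pi> u)" if uv: "u \<in> V" "v \<in> V" for u v
  proof -
    have "\<pi> v \<in> \<pi> ` ch u \<longleftrightarrow> v \<in> ch u"
      using * uv children_in_V by (intro inj_on_image_mem_iff[of \<pi> V]) (auto simp: bij_betw_def)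
    then show ?thesis using * uv by auto
  qed
  then show "rooted_aut T \<pi>"
    using * by (auto simp: rooted_iso_def edge_iff)
qed

end

section \<open>Canonical forms of colored subtrees\<close>

text \<open>Multisets forget the order of the children, so that isomorphic colored subtrees receive
  equal trees.\<close>

datatype 'c ctree = CNode (label: 'c) (subtrees: "'c ctree multiset")

lemma image_mset_eq_imp_bij_betw:
  assumes "finite A" "finite B" "image_mset f (mset_set A) = image_mset g (mset_set B)"
  shows "\<exists>\<beta>. bij_betw \<beta> A B \<and> (\<forall>a\<in>A. f a = g (\<beta> a))"
  using assms
proof (induction A arbitrary: B rule: finite_induct)
  case empty
  then show ?case by (auto simp: mset_set_empty_iff bij_betw_def)
next
  case (insert a A)
  have "f a \<in># image_mset g (mset_set B)"
    using insert.prems(2)[symmetric] insert.hyps by simp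
  then obtain b where b: "b \<in> B" "g b = f a"
    using insert.prems(1) by auto
  have "mset_set B = add_mset b (mset_set (B - {b}))"
    using insert.prems(1) b(1) by (metis mset_set.remove)
  then have "image_mset f (mset_set A) = image_mset g (mset_set (B - {b}))"
    using insert.prems(2) insert.hyps b(2) by simp
  then obtain \<beta> where \<beta>: "bij_betw \<beta> A (B - {b})" "\<forall>a\<in>A. f a = g (\<beta> a)"
    using insert.IH[of "B - {b}"] insert.prems(1) by auto
  have "bij_betw (\<beta>(a := b)) A (B - {b})"
    using \<beta>(1) insert.hyps(2) by (subst bij_betw_cong[where g = \<beta>]) auto
  then have "bij_betw (\<beta>(a := b)) (insert a A) B"
    using notIn_Un_bij_betw[of a A "\<beta>(a := b)" "B - {b}"] insert.hyps(2) b(1) by (simp add: insert_absorb)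
  moreover have "\<forall>x\<in>insert a A. f x = g ((\<beta>(a := b)) x)"
    using \<beta>(2) b(2) insert.hyps(2) by auto
  ultimately show ?case by blast
qed

context rooted_tree_graph
begin

text \<open>Measured against the deepest level of the whole tree instead of the leaves below
  \<open>v\<close>: recursion only needs a value that drops from parent to child.\<close>

definition height :: "'a \<Rightarrow> nat" where
  "height v = Max (dep ` V) - dep v"

lemma height_children:
  assumes "c \<in> ch v"
  shows "height c < height v"
proof -
  have "dep c \<le> Max (dep ` V)"
    using children_in_V[OF assms] finite_V by simp
  then show ?thesis
    using depth_children[OF assms] by (simp add: height_def)
qed

section \<open>Induction and recursion up and down the tree\<close>

lemma bottom_up_induct [consumes 1, case_names step]:
  assumes "v \<in> V" "\<And>v. v \<in> V \<Longrightarrow> (\<And>c. c \<in> ch v \<Longrightarrow> P c) \<Longrightarrow> P v"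
  shows "P v"
  using assms(1)
proof (induction "height v" arbitrary: v rule: less_induct)
  case less
  then show ?case using assms(2) height_children children_in_V by blast
qed

lemma top_down_induct [consumes 1, case_names root child]:
  assumes "v \<in> V" "P r" "\<And>p c. p \<in> V \<Longrightarrow> c \<in> V \<Longrightarrow> c \<in> ch p \<Longrightarrow> P p \<Longrightarrow> P c"
  shows "P v"
  using assms(1)
proof (induction "dep v" arbitrary: v rule: less_induct)
  case less
  show ?case
  proof (cases "v = r")
    case False
    then obtain p where "v \<in> ch p" using less.prems parent_exists by blast
    then show ?thesis
      using less.hyps[of p] less.prems assms(3) children_in_V[of v p] depth_children[of v p] by simp
  qed (simp add: assms(2))
qed

definition parent :: "'a \<Rightarrow> 'a" where
  "parent v = (THE p. v \<in> ch p)"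

lemma parent_eq: "v \<in> ch p \<Longrightarrow> parent v = p"
  unfolding parent_def using parent_unique by blast

lemma depth_parent: "v \<in> V \<Longrightarrow> v \<noteq> r \<Longrightarrow> dep (parent v) < dep v"
  by (metis depth_children lessI parent_eq parent_exists)

text \<open>Here \<open>h p x c\<close> is the value at the child \<open>c\<close> of a vertex
  \<open>p\<close> with value \<open>x\<close>; vertices outside the tree get the root value
  \<open>b\<close> as a default. Both automorphisms and colorings are built this way.\<close>

function top_down :: "'b \<Rightarrow> ('a \<Rightarrow> 'b \<Rightarrow> 'a \<Rightarrow> 'b) \<Rightarrow> 'a \<Rightarrow> 'b" where
  "top_down b h v = (if v \<in> V \<and> v \<noteq> r then h (parent v) (top_down b h (parent v)) v else b)"
  by pat_completeness auto
termination
  by (relation "measure (\<lambda>(b, h, v). dep v)") (auto simp: depth_parent)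

declare top_down.simps [simp del]

lemma top_down_root: "top_down b h r = b"
  by (simp add: top_down.simps)

lemma top_down_child: "c \<in> ch p \<Longrightarrow> top_down b h c = h p (top_down b h p) c"
  using children_in_V[of c p] root_not_child by (subst top_down.simps) (auto simp: parent_eq)

function canon :: "('a \<Rightarrow> 'c) \<Rightarrow> 'a \<Rightarrow> 'c ctree" where
  "canon f v = CNode (f v) (image_mset (canon f) (mset_set (ch v)))"
  by pat_completeness auto
termination
  by (relation "measure (\<lambda>(f, v). height v)") (auto simp: finite_children height_children)

declare canon.simps [simp del]

lemma label_canon: "label (canon f v) = f v"
  by (simp add: canon.simps[of f v])

lemma canon_cong:
  assumes "v \<in> V" "\<And>w. w \<in> V \<Longrightarrow> f w = g w"
  shows "canon f v = canon g v"
  using assms(1)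
proof (induction rule: bottom_up_induct)
  case (step v)
  then show ?case
    by (auto simp: canon.simps[of _ v] finite_children assms(2) intro!: image_mset_cong)
qed

lemma canon_aut:
  assumes "rooted_aut T \<pi>" "\<And>w. w \<in> V \<Longrightarrow> f w = g (\<pi> w)" "v \<in> V"
  shows "canon f v = canon g (\<pi> v)"
  using assms(3)
proof (induction rule: bottom_up_induct)
  case (step v)
  have \<pi>: "bij_betw \<pi> V V" "\<pi> ` ch v = ch (\<pi> v)"
    using assms(1) step(1) by (auto simp: rooted_aut_iff)
  have "inj_on \<pi> (ch v)"
    using \<pi>(1) children_in_V by (meson bij_betw_def inj_on_subset subsetI)
  then have "image_mset (canon g) (mset_set (ch (\<pi> v))) = image_mset (\<lambda>c. canon g (\<pi> c)) (mset_set (ch v))"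
    by (simp add: \<pi>(2)[symmetric] image_mset_mset_set[symmetric] multiset.map_comp comp_def)
  also have "\<dots> = image_mset (canon f) (mset_set (ch v))"
    using step(2) by (intro image_mset_cong) (simp add: finite_children)
  finally show ?case
    using step(1) assms(2) by (simp add: canon.simps[of _ v] canon.simps[of _ "\<pi> v"])
qed

lemma canon_eq_imp_bij:
  assumes "canon f p = canon g q"
  shows "\<exists>\<beta>. bij_betw \<beta> (ch p) (ch q) \<and> (\<forall>c\<in>ch p. canon f c = canon g (\<beta> c))"
proof (rule image_mset_eq_imp_bij_betw[OF finite_children finite_children])
  show "image_mset (canon f) (mset_set (ch p)) = image_mset (canon g) (mset_set (ch q))"
    using assms by (simp add: canon.simps[of f p] canon.simps[of g q])
qed

text \<open>Gluing: the root goes to itself, and once \<open>p\<close> goes to \<open>q\<close>, the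
  children of \<open>p\<close> are sent along \<open>\<beta> p q\<close>. The last conclusion
  records which local bijection was used, so that a caller can prescribe the automorphism at a
  chosen vertex.\<close>

lemma aut_from_local_bijections:
  assumes root: "canon f r = canon g r"
    and \<beta>: "\<And>p q. p \<in> V \<Longrightarrow> q \<in> V \<Longrightarrow> canon f p = canon g q \<Longrightarrow>
      bij_betw (\<beta> p q) (ch p) (ch q) \<and> (\<forall>c\<in>ch p. canon f c = canon g (\<beta> p q c))"
  obtains \<pi> where "rooted_aut T \<pi>" "\<And>v. v \<in> V \<Longrightarrow> f v = g (\<pi> v)"
    "\<And>p c. c \<in> ch p \<Longrightarrow> \<pi> c = \<beta> p (\<pi> p) c"
proof -
  define \<pi> where "\<pi> = top_down r \<beta>"
  have \<pi>c: "\<pi> c = \<beta> p (\<pi> p) c" if "c \<in> ch p" for p c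
    using that by (simp add: \<pi>_def top_down_child)
  have root\<pi>: "\<pi> r = r" by (simp add: \<pi>_def top_down_root)
  have inv: "\<pi> v \<in> V \<and> canon f v = canon g (\<pi> v)" if "v \<in> V" for v
    using that
  proof (induction rule: top_down_induct)
    case root
    then show ?case using root\<pi> root_in_V assms(1) by simp
  next
    case (child p c)
    then have b: "bij_betw (\<beta> p (\<pi> p)) (ch p) (ch (\<pi> p))" "canon f c = canon g (\<beta> p (\<pi> p) c)"
      using \<beta>[of p "\<pi> p"] by auto
    then have "\<beta> p (\<pi> p) c \<in> ch (\<pi> p)"
      using child(3) by (auto dest: bij_betwE)
    then show ?case
      using b(2) \<pi>c[OF child(3)] children_in_V by simp
  qed
  have bij: "bij_betw \<pi> (ch p) (ch (\<pi> p))" if "p \<in> V" for p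
    using \<beta>[of p "\<pi> p"] inv[OF that] that \<pi>c by (subst bij_betw_cong[where g = "\<beta> p (\<pi> p)"]) auto
  have img: "\<pi> c \<in> ch (\<pi> p)" if "c \<in> ch p" for c p
    using bij children_in_V(2)[OF that] that by (auto dest: bij_betwE)
  have depth: "dep (\<pi> v) = dep v" if "v \<in> V" for v
    using that by (induction rule: top_down_induct) (simp_all add: root\<pi> depth_children depth_children[OF img])
  \<comment> \<open>Vertices with equal images have equal depth and, as parents are unique, parents
    with equal images; so injectivity descends from the root. Finiteness then gives
    surjectivity.\<close>
  have "\<forall>v\<in>V. \<pi> u = \<pi> v \<longrightarrow> u = v" if "u \<in> V" for u
    using that
  proof (induction rule: top_down_induct)
    case root
    then show ?case
      using depth root\<pi> depth_eq_0D depth_root by metis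
  next
    case (child p c)
    show ?case
    proof (intro ballI impI)
      fix v assume v: "v \<in> V" "\<pi> c = \<pi> v"
      then have "dep v = dep c" using depth child(2) by metis
      then have "v \<noteq> r" using depth_children[OF child(3)] by auto
      then obtain q where q: "v \<in> ch q" using v parent_exists by blast
      have "\<pi> p = \<pi> q"
        using img[OF child(3)] img[OF q] v(2) parent_unique by metis
      then have "p = q" using child(4) children_in_V(2)[OF q] by blast
      then show "c = v"
        using bij[OF child(1)] child(3) q v(2) by (auto simp: bij_betw_def inj_on_def)
    qed
  qed
  then have inj: "inj_on \<pi> V" by (meson inj_onI)
  then have "\<pi> ` V = V"
    using inv finite_V by (intro endo_inj_surj) auto
  then have "rooted_aut T \<pi>"
    using inj bij root\<pi> by (auto simp: rooted_aut_iff bij_betw_def)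
  moreover have "f v = g (\<pi> v)" if "v \<in> V" for v
    using inv[OF that] label_canon[of f v] label_canon[of g "\<pi> v"] by simp
  ultimately show ?thesis using that \<pi>c by blast
qed

lemma equivalent_colorings_iff: "equivalent_colorings T f T g \<longleftrightarrow> canon f r = canon g r"
proof
  assume "equivalent_colorings T f T g"
  then obtain \<pi> where \<pi>: "rooted_aut T \<pi>" "\<And>v. v \<in> V \<Longrightarrow> f v = g (\<pi> v)"
    by (auto simp: equivalent_colorings_def)
  have "canon f r = canon g (\<pi> r)"
    by (rule canon_aut) (use \<pi> root_in_V in auto)
  then show "canon f r = canon g r"
    using \<pi>(1) by (simp add: rooted_iso_def)
next
  assume eq: "canon f r = canon g r"
  define \<beta> where "\<beta> p q = (SOME \<beta>. bij_betw \<beta> (ch p) (ch q) \<and> (\<forall>c\<in>ch p. canon f c = canon g (\<beta> c)))" for p q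
  have "bij_betw (\<beta> p q) (ch p) (ch q) \<and> (\<forall>c\<in>ch p. canon f c = canon g (\<beta> p q c))"
    if "canon f p = canon g q" for p q
    unfolding \<beta>_def using canon_eq_imp_bij[OF that] by (rule someI_ex)
  then obtain \<pi> where "rooted_aut T \<pi>" "\<And>v. v \<in> V \<Longrightarrow> f v = g (\<pi> v)"
    using aut_from_local_bijections[OF eq, of \<beta>] by metis
  then show "equivalent_colorings T f T g"
    by (auto simp: equivalent_colorings_def)
qed

text \<open>If siblings always have different forms, a color-preserving automorphism fixes the
  children of every fixed vertex. Conversely, two siblings with equal forms can be exchanged by
  gluing, which gives a nontrivial automorphism preserving colors.\<close>

lemma distinguishing_iff: "distinguishing T f \<longleftrightarrow> (\<forall>v\<in>V. inj_on (canon f) (ch v))"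
proof
  assume inj: "\<forall>v\<in>V. inj_on (canon f) (ch v)"
  show "distinguishing T f"
    unfolding distinguishing_def
  proof (intro allI impI ballI, elim conjE)
    fix \<pi> v assume aut: "rooted_aut T \<pi>" and pres: "\<forall>v\<in>V. f (\<pi> v) = f v" and "v \<in> V"
    from \<open>v \<in> V\<close> show "\<pi> v = v"
    proof (induction rule: top_down_induct)
      case root
      then show ?case using aut by (simp add: rooted_iso_def)
    next
      case (child p c)
      have "\<pi> c \<in> ch p"
        using aut child unfolding rooted_aut_iff by (metis imageI)
      moreover have "canon f c = canon f (\<pi> c)"
        by (rule canon_aut[OF aut]) (use pres child in auto)
      ultimately show ?case
        using inj child by (metis inj_onD)
    qed
  qed
next
  assume dist: "distinguishing T f"
  show "\<forall>v\<in>V. inj_on (canon f) (ch v)"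
  proof (intro ballI inj_onI, rule ccontr)
    fix v c d assume v: "v \<in> V" and cd: "c \<in> ch v" "d \<in> ch v" "canon f c = canon f d" "c \<noteq> d"
    \<comment> \<open>The automorphism exchanging the subtrees at \<open>c\<close> and \<open>d\<close>.\<close>
    define swap where "swap x = (if x = c then d else if x = d then c else x)" for x
    define \<beta> where "\<beta> p q = (if p = q then (if p = v then swap else id) else
      (SOME \<beta>. bij_betw \<beta> (ch p) (ch q) \<and> (\<forall>c\<in>ch p. canon f c = canon f (\<beta> c))))" for p q
    have swap: "bij_betw swap (ch v) (ch v)" "canon f (swap x) = canon f x" for x
      using cd by (auto simp: swap_def intro!: bij_betw_byWitness[where f' = swap])
    have \<beta>: "bij_betw (\<beta> p q) (ch p) (ch q) \<and> (\<forall>c\<in>ch p. canon f c = canon f (\<beta> p q c))"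
      if eq: "canon f p = canon f q" for p q
    proof (cases "p = q")
      case True
      then show ?thesis
        using swap by (cases "p = v") (simp_all add: \<beta>_def)
    next
      case False
      then show ?thesis
        unfolding \<beta>_def if_not_P[OF False] by (intro someI_ex[OF canon_eq_imp_bij[OF eq]])
    qed
    obtain \<pi> where \<pi>: "rooted_aut T \<pi>" "\<And>v. v \<in> V \<Longrightarrow> f v = f (\<pi> v)"
      "\<And>p c. c \<in> ch p \<Longrightarrow> \<pi> c = \<beta> p (\<pi> p) c"
      using aut_from_local_bijections[OF refl, of f \<beta>] \<beta> by blast
    \<comment> \<open>The prescribed bijection at \<open>(p, p)\<close> is the identity for
      \<open>p\<close> other than \<open>v\<close>, so nothing moves before the children of
      \<open>v\<close> are reached.\<close>
    have "dep w \<le> dep v \<longrightarrow> \<pi> w = w" if "w \<in> V" for w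
      using that
    proof (induction rule: top_down_induct)
      case root
      then show ?case using \<pi>(1) by (simp add: rooted_iso_def)
    next
      case (child p c)
      then show ?case
        using \<pi>(3)[OF child(3)] depth_children[OF child(3)] by (auto simp: \<beta>_def)
    qed
    then have "\<pi> v = v" using v by simp
    then have "\<pi> c = d" using \<pi>(3)[OF cd(1)] by (simp add: \<beta>_def swap_def)
    moreover have "\<pi> c = c"
      using dist \<pi>(1,2) children_in_V(1)[OF cd(1)] by (auto simp: distinguishing_def)
    ultimately show False using cd(4) by simp
  qed
qed

text \<open>The forms of distinguishing colorings of the subtree at \<open>v\<close>. The
  transversals of the children are spelled out, so that the recursive calls visibly occur only at
  children.\<close>

function ctrees :: "('a \<Rightarrow> 'c set) \<Rightarrow> 'a \<Rightarrow> 'c ctree set" where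
  "ctrees L v = {CNode c (mset_set (t ` ch v)) | c t.
     c \<in> L v \<and> inj_on t (ch v) \<and> (\<forall>w\<in>ch v. t w \<in> ctrees L w)}"
  by pat_completeness auto
termination
  by (relation "measure (\<lambda>(f, v). height v)") (auto simp: height_children)

declare ctrees.simps [simp del]

lemma ctrees_eq:
  "ctrees L v = (\<lambda>(c, X). CNode c (mset_set X)) ` (L v \<times> transversals (ch v) (ctrees L))"
  by (subst ctrees.simps) (auto simp: transversals_def image_iff, blast+)

lemma inj_on_CNode_transversals:
  "inj_on (\<lambda>(c, X). CNode c (mset_set X)) (C \<times> transversals (ch v) A)"
  by (auto intro!: inj_onI dest!: transversals_finite_mem[OF finite_children])

lemma card_ctrees: "card (ctrees L v) = card (L v) * card (transversals (ch v) (ctrees L))"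
  unfolding ctrees_eq[of L v] by (simp add: card_image inj_on_CNode_transversals card_cartesian_product)

lemma finite_ctrees:
  assumes "v \<in> V" "\<And>w. w \<in> V \<Longrightarrow> finite (L w)"
  shows "finite (ctrees L v)"
  using assms(1)
proof (induction rule: bottom_up_induct)
  case (step v)
  then show ?case
    using assms(2) unfolding ctrees_eq[of L v] by (auto intro!: finite_transversals finite_children)
qed

definition shape :: "'a \<Rightarrow> unit ctree" where
  "shape v = canon (\<lambda>_. ()) v"

text \<open>Forgetting the colors recovers the shape; hence class sets of vertices with different
  shapes are disjoint.\<close>

lemma shape_ctrees:
  assumes "v \<in> V" "t \<in> ctrees L v"
  shows "map_ctree (\<lambda>_. ()) t = shape v"
  using assms
proof (induction arbitrary: t rule: bottom_up_induct)
  case (step v)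
  then obtain c g where t: "t = CNode c (mset_set (g ` ch v))" "inj_on g (ch v)" "\<And>w. w \<in> ch v \<Longrightarrow> g w \<in> ctrees L w"
    by (auto simp: ctrees.simps[of L v])
  have "image_mset (\<lambda>w. map_ctree (\<lambda>_. ()) (g w)) (mset_set (ch v)) = image_mset shape (mset_set (ch v))"
    using step(2) t(3) by (intro image_mset_cong) (simp add: finite_children)
  then show ?case
    by (simp add: t(1) shape_def[of v] canon.simps[of _ v] image_mset_mset_set[OF t(2), symmetric]
        multiset.map_comp comp_def shape_def[abs_def])
qed

lemma ctrees_disjoint:
  assumes "u \<in> V" "v \<in> V" "shape u \<noteq> shape v"
  shows "ctrees L u \<inter> ctrees L v = {}"
  using assms shape_ctrees by (metis disjoint_iff)

lemma canon_in_ctrees: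
  assumes "v \<in> V" "\<And>w. w \<in> V \<Longrightarrow> f w \<in> L w" "\<And>w. w \<in> V \<Longrightarrow> inj_on (canon f) (ch w)"
  shows "canon f v \<in> ctrees L v"
  using assms(1)
proof (induction rule: bottom_up_induct)
  case (step v)
  have "canon f v = CNode (f v) (mset_set (canon f ` ch v))"
    using assms(3)[OF step(1)] by (simp add: canon.simps[of f v] image_mset_mset_set)
  then show ?case
    using assms(2,3) step by (subst ctrees.simps) blast
qed

text \<open>A form lists its child forms without saying which child carries which. Choosing such an
  assignment at each vertex from the root downwards labels every vertex with a form, and the labels
  of these forms are the coloring.\<close>

lemma ctrees_imp_canon:
  assumes "t \<in> ctrees L r"
  obtains f where "canon f r = t" "\<And>v. v \<in> V \<Longrightarrow> f v \<in> L v" "\<And>v. v \<in> V \<Longrightarrow> inj_on (canon f) (ch v)"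
proof -
  define h where "h p t = (SOME g. subtrees t = mset_set (g ` ch p) \<and> inj_on g (ch p) \<and>
    (\<forall>w\<in>ch p. g w \<in> ctrees L w))" for p t
  have h: "subtrees t = mset_set (h p t ` ch p) \<and> inj_on (h p t) (ch p) \<and> (\<forall>w\<in>ch p. h p t w \<in> ctrees L w)"
    if "t \<in> ctrees L p" for p t
  proof -
    have "\<exists>g. subtrees t = mset_set (g ` ch p) \<and> inj_on g (ch p) \<and> (\<forall>w\<in>ch p. g w \<in> ctrees L w)"
      using that by (subst (asm) ctrees.simps) auto
    then show ?thesis unfolding h_def by (rule someI_ex)
  qed
  define \<tau> where "\<tau> = top_down t h"
  have \<tau>r: "\<tau> r = t" by (simp add: \<tau>_def top_down_root)
  have \<tau>c: "\<tau> c = h p (\<tau> p) c" if "c \<in> ch p" for p c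
    using that by (simp add: \<tau>_def top_down_child)
  have mem: "\<tau> v \<in> ctrees L v" if "v \<in> V" for v
    using that by (induction rule: top_down_induct) (auto simp: \<tau>r \<tau>c assms dest: h)
  define f where "f v = label (\<tau> v)" for v
  have sub: "subtrees (\<tau> v) = mset_set (\<tau> ` ch v)" and inj: "inj_on \<tau> (ch v)" if "v \<in> V" for v
  proof -
    have "\<tau> ` ch v = h v (\<tau> v) ` ch v" using \<tau>c by (auto simp: image_iff)
    then show "subtrees (\<tau> v) = mset_set (\<tau> ` ch v)" using h[OF mem[OF that]] by simp
    show "inj_on \<tau> (ch v)" using h[OF mem[OF that]] \<tau>c by (auto simp: inj_on_def)
  qed
  have canon: "canon f v = \<tau> v" if "v \<in> V" for v
    using that
  proof (induction rule: bottom_up_induct)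
    case (step v)
    have "image_mset (canon f) (mset_set (ch v)) = image_mset \<tau> (mset_set (ch v))"
      using step(2) by (intro image_mset_cong) (simp add: finite_children)
    also have "\<dots> = subtrees (\<tau> v)"
      using sub[OF step(1)] inj[OF step(1)] by (simp add: image_mset_mset_set)
    finally have "canon f v = CNode (label (\<tau> v)) (subtrees (\<tau> v))"
      by (subst canon.simps) (simp add: f_def)
    then show ?case by simp
  qed
  show ?thesis
  proof (rule that[of f])
    show "canon f r = t" using canon[OF root_in_V] \<tau>r by simp
    show "f v \<in> L v" if "v \<in> V" for v
      using mem[OF that] unfolding f_def by (subst (asm) ctrees.simps) auto
    show "inj_on (canon f) (ch v)" if "v \<in> V" for v
      using inj[OF that] canon children_in_V by (auto simp: inj_on_def)
  qed
qed

lemma canon_image_dist_list_colorings: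
  "(\<lambda>f. canon f r) ` dist_list_colorings T L = ctrees L r"
proof (intro equalityI subsetI)
  fix t assume "t \<in> ctrees L r"
  then obtain f where f: "canon f r = t" "\<And>v. v \<in> V \<Longrightarrow> f v \<in> L v" "\<And>v. v \<in> V \<Longrightarrow> inj_on (canon f) (ch v)"
    by (rule ctrees_imp_canon) blast
  \<comment> \<open>Colorings are extensional, and canonical forms depend only on the values on the
    vertices.\<close>
  let ?f = "restrict f V"
  have eq: "canon ?f v = canon f v" if "v \<in> V" for v
    by (rule canon_cong[OF that]) simp
  have "inj_on (canon ?f) (ch v)" if "v \<in> V" for v
    using f(3)[OF that] eq children_in_V by (auto simp: inj_on_def)
  then have "?f \<in> dist_list_colorings T L"
    using f(2) by (auto simp: dist_list_colorings_def distinguishing_iff)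
  then show "t \<in> (\<lambda>f. canon f r) ` dist_list_colorings T L"
    using eq[OF root_in_V] f(1) by (intro image_eqI[of _ _ ?f]) auto
qed (auto simp: dist_list_colorings_def distinguishing_iff intro!: canon_in_ctrees root_in_V)

end

lemma card_quotient_kernel:
  "card (A // {(x, y) \<in> A \<times> A. F x = F y}) = card (F ` A)"
proof -
  let ?c = "\<lambda>y. {x \<in> A. F x = y}"
  have "{(x, y) \<in> A \<times> A. F x = F y} `` {x} = ?c (F x)" if "x \<in> A" for x
    using that by auto
  then have "A // {(x, y) \<in> A \<times> A. F x = F y} = ?c ` F ` A"
    unfolding quotient_def by (simp add: UNION_singleton_eq_range image_image)
  moreover have "inj_on ?c (F ` A)"
    by (auto simp: inj_on_def)
  ultimately show ?thesis by (simp add: card_image)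
qed

lemma (in rooted_tree_graph) num_dist_list_eq: "num_dist_list T L = card (ctrees L r)"
  unfolding num_dist_list_def equivalent_colorings_iff
  by (simp only: card_quotient_kernel[where F = "\<lambda>f. canon f r"] canon_image_dist_list_colorings)

section \<open>Comparing list colorings with colorings from a fixed set\<close>

context rooted_tree_graph
begin

text \<open>Equal shapes give a bijection of the children that preserves shapes, along which the
  transversals can be reindexed. This is the constancy on fibers asked of \<open>B\<close> in
  \<open>card_transversals_compare\<close>.\<close>

lemma ctrees_const_eq:
  assumes "u \<in> V" "v \<in> V" "shape u = shape v"
  shows "ctrees (\<lambda>_. C) u = ctrees (\<lambda>_. C) v"
  using assms
proof (induction arbitrary: v rule: bottom_up_induct)
  case (step u)
  obtain \<beta> where \<beta>: "bij_betw \<beta> (ch u) (ch v)" "\<And>c. c \<in> ch u \<Longrightarrow> shape c = shape (\<beta> c)"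
    using canon_eq_imp_bij[of "\<lambda>_. ()" u "\<lambda>_. ()" v] step.prems(2) by (auto simp: shape_def)
  have "ctrees (\<lambda>_. C) c = ctrees (\<lambda>_. C) (\<beta> c)" if "c \<in> ch u" for c
    using step.IH[OF that _ \<beta>(2)[OF that]] bij_betwE[OF \<beta>(1)] that children_in_V by blast
  then have "transversals (ch u) (ctrees (\<lambda>_. C)) = transversals (ch v) (ctrees (\<lambda>_. C))"
    by (rule transversals_reindex[OF \<beta>(1)])
  then show ?case
    by (simp add: ctrees_eq[of _ u] ctrees_eq[of _ v])
qed

text \<open>The nonzero equality case, localized at a vertex so that it can be passed down the tree.
  The colors of \<open>C\<close> may have another type than those of \<open>L\<close>, since only
  cardinalities are compared.\<close>

definition tight :: "('a \<Rightarrow> 'c set) \<Rightarrow> 'd set \<Rightarrow> 'a \<Rightarrow> bool" where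
  "tight L C v \<longleftrightarrow> card (ctrees L v) = card (ctrees (\<lambda>_. C) v) \<and> ctrees L v \<noteq> {}"

context
  fixes L :: "'a \<Rightarrow> 'c set" and C :: "'d set"
  assumes card_L: "\<And>v. v \<in> V \<Longrightarrow> card (L v) = card C"
    and C: "finite C" "C \<noteq> {}"
begin

section \<open>The inequality and its equality case\<close>

lemma finite_L: "v \<in> V \<Longrightarrow> finite (L v)"
  using card_L[of v] C by (metis card_0_eq card.infinite)

lemma transversals_children_compare:
  assumes "v \<in> V" "\<And>c. c \<in> ch v \<Longrightarrow> card (ctrees (\<lambda>_. C) c) \<le> card (ctrees L c)"
  shows "card (transversals (ch v) (ctrees (\<lambda>_. C))) \<le> card (transversals (ch v) (ctrees L)) \<and>
    (card (transversals (ch v) (ctrees L)) = card (transversals (ch v) (ctrees (\<lambda>_. C))) \<longrightarrow>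
      card (transversals (ch v) (ctrees (\<lambda>_. C))) > 0 \<longrightarrow>
      (\<forall>c\<in>ch v. card (ctrees L c) = card (ctrees (\<lambda>_. C) c)) \<and>
      (\<forall>c\<in>ch v. \<forall>d\<in>ch v. shape c = shape d \<longrightarrow> ctrees L c = ctrees L d))"
proof (rule card_transversals_compare)
  fix c assume c: "c \<in> ch v"
  then have cV: "c \<in> V" by (rule children_in_V)
  show "finite (ctrees L c)" by (rule finite_ctrees[OF cV finite_L])
  show "finite (ctrees (\<lambda>_. C) c)" by (rule finite_ctrees[OF cV C(1)])
  fix d assume "d \<in> ch v"
  then have dV: "d \<in> V" by (rule children_in_V)
  show "ctrees L c \<inter> ctrees L d = {}" "ctrees (\<lambda>_. C) c \<inter> ctrees (\<lambda>_. C) d = {}"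
    if "shape c \<noteq> shape d"
    using ctrees_disjoint[OF cV dV that] by blast+
  show "ctrees (\<lambda>_. C) c = ctrees (\<lambda>_. C) d" if "shape c = shape d"
    by (rule ctrees_const_eq[OF cV dV that])
qed (use assms finite_children in auto)

lemma card_ctrees_ge:
  assumes "v \<in> V"
  shows "card (ctrees (\<lambda>_. C) v) \<le> card (ctrees L v)"
  using assms
proof (induction rule: bottom_up_induct)
  case (step v)
  then show ?case
    using transversals_children_compare[OF step] card_L
    by (simp add: card_ctrees[of _ v])
qed

text \<open>The positive number of root colors cancels from both counts, so the numbers of
  transversals agree and the equality case of the comparison applies to the children.\<close>

lemma tight_children:
  assumes "v \<in> V" "tight L C v" "c \<in> ch v"
  shows "tight L C c" "d \<in> ch v \<Longrightarrow> shape c = shape d \<Longrightarrow> ctrees L c = ctrees L d"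
proof -
  have "0 < card C" using C by (simp add: card_gt_0_iff)
  then have eq: "card (transversals (ch v) (ctrees L)) = card (transversals (ch v) (ctrees (\<lambda>_. C)))"
    using assms(1,2) card_L by (auto simp: tight_def card_ctrees[of _ v])
  have ne: "transversals (ch v) (ctrees L) \<noteq> {}"
    using assms(2) by (auto simp: tight_def ctrees_eq[of L v])
  then have "0 < card (transversals (ch v) (ctrees L))"
    using finite_transversals[OF finite_children] finite_ctrees finite_L children_in_V
    by (metis card_gt_0_iff)
  then have *: "\<forall>c\<in>ch v. card (ctrees L c) = card (ctrees (\<lambda>_. C) c)"
    "\<forall>c\<in>ch v. \<forall>d\<in>ch v. shape c = shape d \<longrightarrow> ctrees L c = ctrees L d"
    using transversals_children_compare[OF assms(1) card_ctrees_ge[OF children_in_V(1)]] eq by metis+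
  have "ctrees L c \<noteq> {}"
    using ne assms(3) by (auto simp: transversals_def)
  then show "tight L C c" using *(1) assms(3) by (simp add: tight_def)
  show "ctrees L c = ctrees L d" if "d \<in> ch v" "shape c = shape d"
    using *(2) assms(3) that by blast
qed

text \<open>The class set of a child can be read off from the transversals and its shape alone:
  every class occurs in some transversal, and a class of this shape stems from a child of this
  shape, whose class set is the same by tightness.\<close>

lemma ctrees_child_eq:
  assumes "v \<in> V" "tight L C v" "c \<in> ch v"
  shows "ctrees L c = {t \<in> \<Union> (transversals (ch v) (ctrees L)). map_ctree (\<lambda>_. ()) t = shape c}"
proof (intro equalityI subsetI)
  fix t assume t: "t \<in> ctrees L c"
  obtain X where X: "X \<in> transversals (ch v) (ctrees L)"
    using assms(2) by (auto simp: tight_def ctrees_eq[of L v])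
  then obtain g where g: "inj_on g (ch v)" "\<And>w. w \<in> ch v \<Longrightarrow> g w \<in> ctrees L w" "X = g ` ch v"
    by (rule transversalsE) blast
  have "\<exists>Y\<in>transversals (ch v) (ctrees L). t \<in> Y"
  proof (cases "t \<in> X")
    case False
    \<comment> \<open>Exchange: as \<open>t\<close> is not in \<open>X\<close>, it can replace the
      representative of \<open>c\<close>.\<close>
    have "g ` (ch v - {c}) \<in> transversals (ch v - {c}) (ctrees L)"
      using g by (intro transversalsI) (auto intro: inj_on_subset)
    then have "insert t (g ` (ch v - {c})) \<in> transversals (ch v) (ctrees L)"
      by (rule transversals_insert[where A = "ctrees L", OF assms(3) _ t]) (use False g in auto)
    then show ?thesis by blast
  qed (use X in blast)
  then show "t \<in> {t \<in> \<Union> (transversals (ch v) (ctrees L)). map_ctree (\<lambda>_. ()) t = shape c}"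
    using shape_ctrees[OF children_in_V(1)[OF assms(3)] t] by blast
next
  fix t assume "t \<in> {t \<in> \<Union> (transversals (ch v) (ctrees L)). map_ctree (\<lambda>_. ()) t = shape c}"
  then obtain d where d: "d \<in> ch v" "t \<in> ctrees L d" "map_ctree (\<lambda>_. ()) t = shape c"
    by (auto simp: transversals_def)
  then have "shape c = shape d" using shape_ctrees[OF children_in_V(1)[OF d(1)] d(2)] by simp
  then show "t \<in> ctrees L c" using tight_children(2)[OF assms d(1)] d(2) by simp
qed

text \<open>Label and child set decode a form, so equal class sets give equal products; nonemptiness
  allows the two factors to be recovered.\<close>

lemma ctrees_eqD:
  assumes "ctrees L u = ctrees L v" "ctrees L v \<noteq> {}"
  shows "L u = L v" "transversals (ch u) (ctrees L) = transversals (ch v) (ctrees L)"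
proof -
  let ?P = "\<lambda>v. L v \<times> transversals (ch v) (ctrees L)"
  have *: "?P w = (\<lambda>t. (label t, set_mset (subtrees t))) ` ctrees L w" for w
  proof -
    have "(\<lambda>t. (label t, set_mset (subtrees t))) ` ctrees L w
        = (\<lambda>(c, X). (c, set_mset (mset_set X))) ` ?P w"
      unfolding ctrees_eq[of L w] image_image by (rule image_cong) auto
    also have "\<dots> = id ` ?P w"
      by (rule image_cong) (auto simp: transversals_finite_mem[OF finite_children])
    finally show ?thesis by simp
  qed
  have "?P u = ?P v" unfolding * assms(1) ..
  moreover have "?P v \<noteq> {}" using assms(2) ctrees_eq[of L v] by auto
  ultimately show "L u = L v" "transversals (ch u) (ctrees L) = transversals (ch v) (ctrees L)"
    by (auto simp: times_eq_iff)
qed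

text \<open>Equality of class sets is carried down the tree together with tightness: equal class
  sets at \<open>p\<close> and \<open>\<pi> p\<close> give equal transversals, and from these
  \<open>ctrees_child_eq\<close> recovers equal class sets at \<open>c\<close> and
  \<open>\<pi> c\<close>, which have the same shape.\<close>

lemma tight_imp_aut_invariant:
  assumes "tight L C r" "rooted_aut T \<pi>" "v \<in> V"
  shows "L (\<pi> v) = L v"
proof -
  have "tight L C v \<and> tight L C (\<pi> v) \<and> ctrees L (\<pi> v) = ctrees L v"
    using assms(3)
  proof (induction rule: top_down_induct)
    case root
    then show ?case using assms(1,2) by (simp add: rooted_iso_def)
  next
    case (child p c)
    have \<pi>p: "\<pi> p \<in> V" and \<pi>c: "\<pi> c \<in> ch (\<pi> p)"
      using assms(2) child(1,3) bij_betwE unfolding rooted_aut_iff by blast+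
    have "shape c = shape (\<pi> c)"
      unfolding shape_def by (rule canon_aut[OF assms(2)]) (use child in auto)
    moreover have "transversals (ch (\<pi> p)) (ctrees L) = transversals (ch p) (ctrees L)"
      using ctrees_eqD(2)[of "\<pi> p" p] child(4) by (simp add: tight_def)
    ultimately have "ctrees L (\<pi> c) = ctrees L c"
      using ctrees_child_eq[OF \<pi>p _ \<pi>c] ctrees_child_eq[OF child(1) _ child(3)] child(4) by simp
    then show ?case
      using tight_children(1)[OF \<pi>p _ \<pi>c] tight_children(1)[OF child(1) _ child(3)] child(4) by simp
  qed
  then show ?thesis using ctrees_eqD(1)[of "\<pi> v" v] by (simp add: tight_def)
qed

end

section \<open>Lists constant on orbits: recoloring\<close>

lemma constant_on_orbits_iff:
  "(\<forall>Q\<in>vertex_orbits T. \<forall>u\<in>Q. \<forall>v\<in>Q. L u = L v) \<longleftrightarrow>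
    (\<forall>\<pi> v. rooted_aut T \<pi> \<longrightarrow> v \<in> V \<longrightarrow> L (\<pi> v) = L v)"
proof -
  \<comment> \<open>The identity puts each vertex into its own orbit.\<close>
  have "rooted_aut T id" by (auto simp: rooted_iso_def)
  then show ?thesis
    by (fastforce simp: vertex_orbits_def vertex_orbit_def)
qed

text \<open>Since \<open>h\<close> and \<open>L\<close> are invariant under automorphisms, applying
  \<open>h v\<close> at each vertex preserves and reflects every relation
  \<open>f v = g (\<pi> v)\<close>. Both being distinguishing and equivalence are made of such
  relations.\<close>

lemma num_dist_list_recolor:
  fixes L :: "'a \<Rightarrow> 'c set" and M :: "'a \<Rightarrow> 'd set"
  assumes bij: "\<And>v. v \<in> V \<Longrightarrow> bij_betw (h v) (L v) (M v)"
    and invh: "\<And>\<pi> v. rooted_aut T \<pi> \<Longrightarrow> v \<in> V \<Longrightarrow> h (\<pi> v) = h v"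
    and invL: "\<And>\<pi> v. rooted_aut T \<pi> \<Longrightarrow> v \<in> V \<Longrightarrow> L (\<pi> v) = L v"
  shows "num_dist_list T L = num_dist_list T M"
proof -
  define \<Phi> where "\<Phi> f = restrict (\<lambda>v. h v (f v)) V" for f
  let ?A = "dist_list_colorings T L" and ?B = "dist_list_colorings T M"
  have key: "\<Phi> f v = \<Phi> g (\<pi> v) \<longleftrightarrow> f v = g (\<pi> v)"
    if "rooted_aut T \<pi>" "v \<in> V" "f \<in> Pi\<^sub>E V L" "g \<in> Pi\<^sub>E V L" for \<pi> v f g
  proof -
    have \<pi>v: "\<pi> v \<in> V" using that(1,2) by (auto simp: rooted_iso_def dest: bij_betwE)
    \<comment> \<open>Invariance of \<open>L\<close> puts both colors into the one list on which
      \<open>h v\<close> is injective.\<close>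
    have "f v \<in> L v" "g (\<pi> v) \<in> L v"
      using that \<pi>v invL[OF that(1,2)] by (auto dest: PiE_mem)
    then show ?thesis
      using bij[OF that(2)] that(2) \<pi>v invh[OF that(1,2)] by (auto simp: \<Phi>_def bij_betw_def inj_on_def)
  qed
  have dist: "distinguishing T (\<Phi> f) \<longleftrightarrow> distinguishing T f" if "f \<in> Pi\<^sub>E V L" for f
  proof -
    have "(\<forall>v\<in>V. \<Phi> f (\<pi> v) = \<Phi> f v) \<longleftrightarrow> (\<forall>v\<in>V. f (\<pi> v) = f v)" if "rooted_aut T \<pi>" for \<pi>
      using key[OF that _ \<open>f \<in> Pi\<^sub>E V L\<close> \<open>f \<in> Pi\<^sub>E V L\<close>] by metis
    then show ?thesis unfolding distinguishing_def by blast
  qed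
  have "canon f r = canon g r \<longleftrightarrow> canon (\<Phi> f) r = canon (\<Phi> g) r" if "f \<in> ?A" "g \<in> ?A" for f g
    using that key[of _ _ f g]
    unfolding equivalent_colorings_iff[symmetric] equivalent_colorings_def dist_list_colorings_def
    by (metis (no_types, lifting) mem_Collect_eq)
  then have "{(f, g) \<in> ?A \<times> ?A. canon f r = canon g r} = {(f, g) \<in> ?A \<times> ?A. canon (\<Phi> f) r = canon (\<Phi> g) r}"
    by auto
  then have "card ((\<lambda>f. canon f r) ` ?A) = card ((\<lambda>f. canon (\<Phi> f) r) ` ?A)"
    unfolding card_quotient_kernel[of ?A "\<lambda>f. canon f r", symmetric]
      card_quotient_kernel[of ?A "\<lambda>f. canon (\<Phi> f) r", symmetric] by simp
  moreover have image: "\<Phi> ` ?A = ?B"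
  proof (intro equalityI subsetI)
    fix g assume "g \<in> \<Phi> ` ?A"
    then obtain f where f: "g = \<Phi> f" "f \<in> ?A" by blast
    then have "f \<in> Pi\<^sub>E V L" by (simp add: dist_list_colorings_def)
    moreover from this have "\<Phi> f \<in> Pi\<^sub>E V M"
      using bij by (auto simp: \<Phi>_def dest: PiE_mem bij_betwE)
    ultimately show "g \<in> ?B" using f dist by (simp add: dist_list_colorings_def)
  next
    fix g assume g: "g \<in> ?B"
    define f where "f = restrict (\<lambda>v. inv_into (L v) (h v) (g v)) V"
    have gM: "g \<in> Pi\<^sub>E V M" using g by (simp add: dist_list_colorings_def)
    have fL: "f \<in> Pi\<^sub>E V L"
      unfolding f_def restrict_PiE_iff
      using bij gM by (metis PiE_mem bij_betw_def inv_into_into)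
    have "\<Phi> f v = g v" for v
    proof (cases "v \<in> V")
      case True
      then show ?thesis
        using bij_betw_inv_into_right[OF bij[OF True]] PiE_mem[OF gM True] by (simp add: \<Phi>_def f_def)
    next
      case False
      then show ?thesis using PiE_arb[OF gM False] by (simp add: \<Phi>_def)
    qed
    then have "\<Phi> f = g" by blast
    moreover from this have "f \<in> ?A"
      using dist[OF fL] fL g by (simp add: dist_list_colorings_def)
    ultimately show "g \<in> \<Phi> ` ?A" by blast
  qed
  have "(\<lambda>f. canon (\<Phi> f) r) ` ?A = (\<lambda>f. canon f r) ` ?B"
    by (simp add: image[symmetric] image_image)
  ultimately show ?thesis
    by (simp add: num_dist_list_eq canon_image_dist_list_colorings)
qed

end

theorem theorem5:
  fixes T :: "'a rooted_graph" and L :: "'a \<Rightarrow> 'c set" and k :: nat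
  assumes "rooted_tree T"
    and "k \<ge> 1"
    and "\<forall>v\<in>tverts T. card (L v) = k"
  shows "num_dist_list T L \<ge> num_dist T k \<and>
    (num_dist_list T L = num_dist T k \<longleftrightarrow>
       num_dist_list T L = 0 \<or>
       (\<forall>Q\<in>vertex_orbits T. \<forall>u\<in>Q. \<forall>v\<in>Q. L u = L v))"
proof -
  interpret rooted_tree_graph T
    by unfold_locales (rule assms(1))
  let ?C = "{1..k}"
  have card_L: "card (L v) = card ?C" if "v \<in> V" for v
    using assms(3) that by simp
  have C: "finite ?C" "?C \<noteq> {}"
    using assms(2) by auto
  have fin_L: "finite (L v)" if "v \<in> V" for v
    using assms(2,3) that by (metis card.infinite not_one_le_zero)
  have ge: "num_dist T k \<le> num_dist_list T L"
    unfolding num_dist_def num_dist_list_eq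
    by (rule card_ctrees_ge[where L = L, OF card_L C root_in_V])
  have "\<forall>\<pi> v. rooted_aut T \<pi> \<longrightarrow> v \<in> V \<longrightarrow> L (\<pi> v) = L v"
    if "num_dist_list T L = num_dist T k" "num_dist_list T L \<noteq> 0"
  proof -
    have "tight L ?C r"
      using that unfolding num_dist_def num_dist_list_eq tight_def by auto
    then show ?thesis
      using tight_imp_aut_invariant[where L = L, OF card_L C] by blast
  qed
  moreover have "num_dist_list T L = num_dist T k"
    if inv: "\<forall>\<pi> v. rooted_aut T \<pi> \<longrightarrow> v \<in> V \<longrightarrow> L (\<pi> v) = L v"
  proof -
    \<comment> \<open>The bijection is chosen for the list and not for the vertex, so that vertices
      in one orbit, having the same list, are recolored alike.\<close>
    define h where "h X = (SOME b. bij_betw b X ?C)" for X :: "'c set"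
    have "bij_betw (h (L v)) (L v) ?C" if "v \<in> V" for v
      unfolding h_def
      using finite_same_card_bij[OF fin_L[OF that] C(1) card_L[OF that]] by (rule someI_ex)
    then show ?thesis
      unfolding num_dist_def by (rule num_dist_list_recolor[where h = "\<lambda>v. h (L v)"]) (use inv in auto)
  qed
  ultimately show ?thesis
    using ge unfolding constant_on_orbits_iff by fastforce
qed

end
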